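(* Let $n$ be a positive integer and let $S$ be a set of $2n+1$ points in the plane in general position (no three collinear and no four concyclic). Let $a$ and $b$ be nonnegative integers with $a<b$ and $a+b=2n-2$. Then the number of circles through three points of $S$ that are either $(a,b)$-splitting or $(b,a)$-splitting is exactly $2(a+1)(b+1)$.
   Context: A circle passing through three points $P_i,P_j,P_k$ of $S$ is called $(a,b)$-splitting (where $a+b=2n-2$) if it has exactly $a$ points of $S$ in its interior and the remaining $b$ points of $S$ in its exterior. Since no four points of $S$ are concyclic, each such circle corresponds to a unique $3$-element subset of $S$. *)

theory Defs
  imports "HOL-Analysis.Analysis"
begin

type_synonym point = "real^2"

definition is_circle :: "point set \<Rightarrow> bool" where
  "is_circle C \<longleftrightarrow> (\<exists>c r. r > 0 \<and> C = sphere c r)"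

definition concyclic :: "point set \<Rightarrow> bool" where
  "concyclic T \<longleftrightarrow> (\<exists>C. is_circle C \<and> T \<subseteq> C)"

definition general_position :: "point set \<Rightarrow> bool" where
  "general_position S \<longleftrightarrow>
     (\<forall>T. T \<subseteq> S \<and> card T = 3 \<longrightarrow> \<not> collinear T) \<and>
     (\<forall>T. T \<subseteq> S \<and> card T = 4 \<longrightarrow> \<not> concyclic T)"

definition through_three :: "point set \<Rightarrow> point set \<Rightarrow> bool" where
  "through_three S C \<longleftrightarrow> (\<exists>T. T \<subseteq> S \<and> card T = 3 \<and> T \<subseteq> C)"

text \<open>
  A circle is its set of boundary points. In the plane its centre and radius are
  determined by that set, so the choice of \<open>c\<close> and \<open>r\<close> below is immaterial.
  The open disc \<open>ball c r\<close> is the interior of the circle, and the complement of the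
  closed disc \<open>cball c r\<close> is its exterior.
\<close>

definition splitting :: "point set \<Rightarrow> nat \<Rightarrow> nat \<Rightarrow> point set \<Rightarrow> bool" where
  "splitting S a b C \<longleftrightarrow> through_three S C \<and>
     (\<exists>c r. r > 0 \<and> C = sphere c r \<and>
        card (S \<inter> ball c r) = a \<and> card (S - cball c r) = b)"

end

(* Lift the points to a paraboloid, so that circles become planes, and sort them by a generic linear
   coordinate u.  For a subset R, cutting the convex hull of the lifted points with the plane u = u(v)
   shows that each v in R other than the two extremes of u is the middle vertex of exactly one upper
   facet, so R has card R - 2 triples without a point of R above their plane.  Summing over all R of
   size s + 3 gives, with q(j) the number of triples of S having j points below their plane,
   sum_j q(j) (j choose s) = (s + 1) (card S choose (s + 3)).  This triangular system has the unique
   solution q(j) = (j + 1) (card S - 2 - j); the points below the plane are those inside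
   or those outside the circle, depending on the orientation of the triple. *)

theory Submission
  imports Defs
begin

section \<open>Binomial sums\<close>

text \<open>The system is unitriangular: \<open>j choose s\<close> vanishes for \<open>j < s\<close>
  and is 1 for \<open>j = s\<close>. The values are therefore determined one at a time, from the top
  index \<open>M\<close> downwards.\<close>

lemma sum_choose_eq_imp_eq:
  fixes f g :: "nat \<Rightarrow> nat"
  assumes eq: "\<And>s. s \<le> M \<Longrightarrow> (\<Sum>j\<le>M. f j * (j choose s)) = (\<Sum>j\<le>M. g j * (j choose s))"
    and "j \<le> M"
  shows "f j = g j"
  using \<open>j \<le> M\<close>
proof (induction "M - j" arbitrary: j rule: less_induct)
  case less
  have split: "(\<Sum>i\<le>M. h i * (i choose j)) = h j + (\<Sum>i\<in>{j<..M}. h i * (i choose j))" for h :: "nat \<Rightarrow> nat"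
  proof -
    have "{..M} = {..<j} \<union> ({j} \<union> {j<..M})" using less.prems by auto
    also have "(\<Sum>i\<in>\<dots>. h i * (i choose j)) = (\<Sum>i<j. h i * (i choose j)) + (\<Sum>i\<in>{j} \<union> {j<..M}. h i * (i choose j))"
      by (rule sum.union_disjoint) auto
    also have "(\<Sum>i<j. h i * (i choose j)) = 0" by simp
    finally show ?thesis by simp
  qed
  have "(\<Sum>i\<in>{j<..M}. f i * (i choose j)) = (\<Sum>i\<in>{j<..M}. g i * (i choose j))"
    by (rule sum.cong) (use less.hyps in auto)
  with split[of f] split[of g] eq[OF less.prems] show ?case by simp
qed

text \<open>An iterated hockey-stick sum. Raising \<open>M\<close> by one adds one more copy of
  every term; these copies sum to \<open>(M + 3) choose (s + 2)\<close>, and Pascal's rule completes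
  the step.\<close>

lemma sum_diff_mult_choose:
  "(\<Sum>j\<le>M. (Suc M - j) * (Suc j choose Suc s)) = (M + 3) choose (s + 3)"
proof (induction M)
  case 0
  show ?case by (cases s) (simp_all add: numeral_3_eq_3)
next
  case (Suc M)
  have "(\<Sum>j\<le>Suc M. (Suc (Suc M) - j) * (Suc j choose Suc s))
      = (\<Sum>j\<le>Suc M. (Suc M - j) * (Suc j choose Suc s) + (Suc j choose Suc s))"
    by (rule sum.cong) (auto simp: Suc_diff_le)
  also have "\<dots> = (\<Sum>j\<le>M. (Suc M - j) * (Suc j choose Suc s)) + (\<Sum>j\<le>Suc M. Suc j choose Suc s)"
    by (simp add: sum.distrib)
  also have "(\<Sum>j\<le>Suc M. Suc j choose Suc s) = (\<Sum>j\<le>Suc (Suc M). j choose Suc s)"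
    by (subst (2) sum.atMost_Suc_shift) simp
  also have "\<dots> = (M + 3) choose (s + 2)"
    by (simp add: sum_choose_upper numeral_3_eq_3 del: sum.atMost_Suc)
  finally show ?case using Suc.IH by (simp add: numeral_3_eq_3)
qed

text \<open>This exhibits the solution of the triangular system whose right-hand side comes from the
  double count over subsets. Absorption turns \<open>Suc j * (j choose s)\<close> into
  \<open>Suc s * (Suc j choose Suc s)\<close>.\<close>

lemma sum_mult_choose:
  "(\<Sum>j\<le>M. Suc j * (Suc M - j) * (j choose s)) = Suc s * ((M + 3) choose (s + 3))"
proof -
  have "Suc j * (Suc M - j) * (j choose s) = Suc s * ((Suc M - j) * (Suc j choose Suc s))" for j
    using Suc_times_binomial_eq[of j s] by (metis mult.assoc mult.commute)
  then show ?thesis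
    by (simp only: sum_distrib_left[symmetric] sum_diff_mult_choose)
qed

section \<open>Counting sorted triples\<close>

text \<open>For \<open>u\<close> injective on \<open>R\<close>, every three-element subset of
  \<open>R\<close> has exactly one such ordering.\<close>

definition sorted_triples :: "('a \<Rightarrow> real) \<Rightarrow> 'a set \<Rightarrow> ('a \<times> 'a \<times> 'a) set" where
  "sorted_triples u R = {(a, v, b). a \<in> R \<and> v \<in> R \<and> b \<in> R \<and> u a < u v \<and> u v < u b}"

lemma finite_sorted_triples: "finite R \<Longrightarrow> finite (sorted_triples u R)"
  by (rule finite_subset[of _ "R \<times> R \<times> R"]) (auto simp: sorted_triples_def)

lemma card_between:
  fixes u :: "'a \<Rightarrow> real"
  assumes "finite R" "inj_on u R" "card R \<ge> 2"
  shows "card {v \<in> R. (\<exists>a\<in>R. u a < u v) \<and> (\<exists>b\<in>R. u v < u b)} = card R - 2"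
proof -
  have "R \<noteq> {}" using assms by auto
  obtain l where l: "l \<in> R" "\<And>x. x \<in> R \<Longrightarrow> u l \<le> u x"
    using ex_min_if_finite[of "u ` R"] \<open>finite R\<close> \<open>R \<noteq> {}\<close> by (auto simp: not_less)
  have "Max (u ` R) \<in> u ` R" "\<And>x. x \<in> R \<Longrightarrow> u x \<le> Max (u ` R)"
    using \<open>finite R\<close> \<open>R \<noteq> {}\<close> by auto
  then obtain h where h: "h \<in> R" "\<And>x. x \<in> R \<Longrightarrow> u x \<le> u h" by auto
  have "l \<noteq> h"
  proof
    assume "l = h"
    then have "R \<subseteq> {l}" using l h inj_onD[OF \<open>inj_on u R\<close>] by (fastforce intro: antisym)
    then have "card R \<le> card {l}" by (intro card_mono) auto
    then show False using assms by simp
  qed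
  have "{v \<in> R. (\<exists>a\<in>R. u a < u v) \<and> (\<exists>b\<in>R. u v < u b)} = R - {l, h}"
  proof (intro equalityI subsetI)
    fix v assume "v \<in> R - {l, h}"
    then have "u l \<noteq> u v" "u h \<noteq> u v" "v \<in> R" using l h inj_onD[OF \<open>inj_on u R\<close>] by blast+
    then show "v \<in> {v \<in> R. (\<exists>a\<in>R. u a < u v) \<and> (\<exists>b\<in>R. u v < u b)}"
      using l(1) h(1) l(2)[of v] h(2)[of v] by force
  qed (use l h in force)
  then show ?thesis using l(1) h(1) \<open>l \<noteq> h\<close> by (simp add: card_Diff_subset)
qed

text \<open>\<open>P a v b p\<close> stands for the lifted \<open>p\<close> lying above the plane
  through the lifted \<open>a\<close>, \<open>v\<close>, \<open>b\<close>; it is later the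
  positivity of \<open>incircle\<close>.\<close>

definition above_free :: "('a \<Rightarrow> 'a \<Rightarrow> 'a \<Rightarrow> 'a \<Rightarrow> bool) \<Rightarrow> 'a set \<Rightarrow> 'a \<times> 'a \<times> 'a \<Rightarrow> bool" where
  "above_free P R = (\<lambda>(a, v, b). \<forall>p\<in>R - {a, v, b}. \<not> P a v b p)"

text \<open>Projection to the middle entry is a bijection onto the points that are not extreme for
  \<open>u\<close>: existence in \<open>ex1\<close> makes it surjective, uniqueness makes it
  injective.\<close>

lemma card_above_free:
  fixes u :: "'a \<Rightarrow> real"
  assumes fin: "finite R" and inj: "inj_on u R" and card: "card R \<ge> 2"
    and ex1: "\<And>v. \<lbrakk>v \<in> R; \<exists>a\<in>R. u a < u v; \<exists>b\<in>R. u v < u b\<rbrakk> \<Longrightarrow>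
      \<exists>!(a, b). (a, v, b) \<in> sorted_triples u R \<and> above_free P R (a, v, b)"
  shows "card {t \<in> sorted_triples u R. above_free P R t} = card R - 2"
proof -
  let ?T = "{t \<in> sorted_triples u R. above_free P R t}"
  let ?V = "{v \<in> R. (\<exists>a\<in>R. u a < u v) \<and> (\<exists>b\<in>R. u v < u b)}"
  have "bij_betw (\<lambda>(a, v, b). v) ?T ?V"
    unfolding bij_betw_def
  proof (intro conjI equalityI subsetI)
    show "inj_on (\<lambda>(a, v, b). v) ?T"
    proof (rule inj_onI)
      fix s t assume s: "s \<in> ?T" and t: "t \<in> ?T" and eq: "(case s of (a, v, b) \<Rightarrow> v) = (case t of (a, v, b) \<Rightarrow> v)"
      obtain a v b where s': "s = (a, v, b)" by (cases s)
      obtain a' b' where t': "t = (a', v, b')" using eq s' by (cases t) auto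
      have "v \<in> R" "\<exists>a\<in>R. u a < u v" "\<exists>b\<in>R. u v < u b"
        using s unfolding s' sorted_triples_def by auto
      from ex1[OF this] have "(a, b) = (a', b')" using s t unfolding s' t' by blast
      then show "s = t" by (simp add: s' t')
    qed
  next
    fix v assume "v \<in> ?V"
    then obtain a b where "(a, v, b) \<in> ?T" using ex1[of v] by fast
    then show "v \<in> (\<lambda>(a, v, b). v) ` ?T" by force
  qed (auto simp: sorted_triples_def)
  then show ?thesis using card_between[OF fin inj card] by (simp add: bij_betw_same_card)
qed

text \<open>Such an \<open>R\<close> is \<open>{a, v, b}\<close> together with any \<open>s\<close>
  of the points not above its plane.\<close>

lemma card_supersets_above_free:
  assumes "finite S" "a \<in> S" "v \<in> S" "b \<in> S" "distinct [a, v, b]"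
  shows "card {R. R \<subseteq> S \<and> card R = s + 3 \<and> {a, v, b} \<subseteq> R \<and> above_free P R (a, v, b)}
    = card {p \<in> S - {a, v, b}. \<not> P a v b p} choose s" (is "card ?X = card ?N choose s")
proof -
  have "finite ?N" using assms by simp
  have c3: "card {a, v, b} = 3" using assms by simp
  have "bij_betw (\<lambda>K. {a, v, b} \<union> K) {K. K \<subseteq> ?N \<and> card K = s} ?X"
  proof (rule bij_betw_byWitness[where f' = "\<lambda>R. R - {a, v, b}"])
    show "\<forall>K\<in>{K. K \<subseteq> ?N \<and> card K = s}. {a, v, b} \<union> K - {a, v, b} = K" by auto
    show "\<forall>R\<in>?X. {a, v, b} \<union> (R - {a, v, b}) = R" by auto
    show "(\<lambda>K. {a, v, b} \<union> K) ` {K. K \<subseteq> ?N \<and> card K = s} \<subseteq> ?X"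
    proof (rule image_subsetI)
      fix K assume K: "K \<in> {K. K \<subseteq> ?N \<and> card K = s}"
      then have "finite K" using \<open>finite ?N\<close> finite_subset by blast
      then have "card ({a, v, b} \<union> K) = card {a, v, b} + card K" 
        using K by (intro card_Un_disjoint) auto
      then show "{a, v, b} \<union> K \<in> ?X"
        using K assms c3 by (auto simp: above_free_def)
    qed
    show "(\<lambda>R. R - {a, v, b}) ` ?X \<subseteq> {K. K \<subseteq> ?N \<and> card K = s}"
    proof (rule image_subsetI)
      fix R assume R: "R \<in> ?X"
      then have "card (R - {a, v, b}) = card R - card {a, v, b}" by (intro card_Diff_subset) auto
      then have "card (R - {a, v, b}) = s" using R c3 by simp
      then show "R - {a, v, b} \<in> {K. K \<subseteq> ?N \<and> card K = s}"
        using R by (auto simp: above_free_def)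
    qed
  qed
  then show ?thesis using n_subsets[OF \<open>finite ?N\<close>, of s] by (simp add: bij_betw_same_card)
qed

text \<open>Double counting of pairs of an \<open>R\<close> with \<open>s + 3\<close> elements and a
  triple above-free in \<open>R\<close>. Grouped by triples it gives a binomial moment of the level
  counts, grouped by subsets an explicit value; the moments for \<open>s \<le> M\<close> determine
  the counts.\<close>

lemma card_sorted_triples_level:
  fixes u :: "'a \<Rightarrow> real"
  assumes fin: "finite S" and inj: "inj_on u S" and cardS: "card S = M + 3"
    and ex1: "\<And>R v. \<lbrakk>R \<subseteq> S; v \<in> R; \<exists>a\<in>R. u a < u v; \<exists>b\<in>R. u v < u b\<rbrakk> \<Longrightarrow>
      \<exists>!(a, b). (a, v, b) \<in> sorted_triples u R \<and> above_free P R (a, v, b)"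
    and "j \<le> M"
  shows "card {(a, v, b) \<in> sorted_triples u S. card {p \<in> S - {a, v, b}. \<not> P a v b p} = j}
    = (j + 1) * (M - j + 1)"
proof -
  let ?T = "sorted_triples u S"
  define below where "below = (\<lambda>(a, v, b). card {p \<in> S - {a, v, b}. \<not> P a v b p})"
  have finT: "finite ?T" by (rule finite_sorted_triples[OF fin])
  have below_le: "below t \<le> M" if "t \<in> ?T" for t
  proof -
    obtain a v b where t: "t = (a, v, b)" by (cases t)
    have "distinct [a, v, b]" "{a, v, b} \<subseteq> S" using that unfolding t sorted_triples_def by auto
    then have "card (S - {a, v, b}) = M" using cardS by (simp add: card_Diff_subset)
    moreover have "below t \<le> card (S - {a, v, b})"
      unfolding below_def t by (simp, intro card_mono) (use fin in auto)
    ultimately show ?thesis by simp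
  qed
  have "(\<Sum>j\<le>M. card {t \<in> ?T. below t = j} * (j choose s)) = (\<Sum>j\<le>M. (Suc j * (Suc M - j)) * (j choose s))"
    if "s \<le> M" for s
  proof -
    let ?Rs = "{R. R \<subseteq> S \<and> card R = s + 3}"
    let ?rel = "\<lambda>R t. t \<in> sorted_triples u R \<and> above_free P R t"
    have "(\<Sum>j\<le>M. card {t \<in> ?T. below t = j} * (j choose s))
      = (\<Sum>j\<le>M. \<Sum>t\<in>{t \<in> ?T. below t = j}. below t choose s)"
      by simp
    also have "\<dots> = (\<Sum>t\<in>?T. below t choose s)"
      by (rule sum.group) (use finT below_le in auto)
    also have "\<dots> = (\<Sum>t\<in>?T. card {R \<in> ?Rs. ?rel R t})"
    proof (rule sum.cong)
      fix t assume t: "t \<in> ?T"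
      obtain a v b where t': "t = (a, v, b)" by (cases t)
      have *: "a \<in> S" "v \<in> S" "b \<in> S" "distinct [a, v, b]" using t unfolding t' sorted_triples_def by auto
      have "{R \<in> ?Rs. ?rel R t} = {R. R \<subseteq> S \<and> card R = s + 3 \<and> {a, v, b} \<subseteq> R \<and> above_free P R (a, v, b)}"
        using t unfolding t' sorted_triples_def by auto
      then show "below t choose s = card {R \<in> ?Rs. ?rel R t}"
        using card_supersets_above_free[OF fin *, of s P] by (simp add: below_def t')
    qed simp
    also have "\<dots> = (\<Sum>R\<in>?Rs. card {t \<in> ?T. ?rel R t})"
      using sum.swap_restrict[of ?T ?Rs "\<lambda>_ _. 1::nat" "\<lambda>t R. ?rel R t"] finT fin by simp
    \<comment> \<open>Every \<open>R\<close> contributes \<open>card R - 2\<close>, whatever the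
      arrangement of its points.\<close>
    also have "\<dots> = (\<Sum>R\<in>?Rs. s + 1)"
    proof (rule sum.cong)
      fix R assume R: "R \<in> ?Rs"
      have "{t \<in> ?T. ?rel R t} = {t \<in> sorted_triples u R. above_free P R t}"
        using R by (auto simp: sorted_triples_def)
      moreover have "card {t \<in> sorted_triples u R. above_free P R t} = card R - 2"
        by (rule card_above_free) (use R fin finite_subset inj inj_on_subset ex1 in auto)
      ultimately show "card {t \<in> ?T. ?rel R t} = s + 1" using R by simp
    qed simp
    also have "\<dots> = Suc s * ((M + 3) choose (s + 3))"
      using n_subsets[OF fin, of "s + 3"] cardS by simp
    finally show ?thesis by (simp only: sum_mult_choose)
  qed
  from sum_choose_eq_imp_eq[OF this \<open>j \<le> M\<close>]
  have "card {t \<in> ?T. below t = j} = Suc j * (Suc M - j)" .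
  moreover have "{t \<in> ?T. below t = j} = {(a, v, b) \<in> ?T. card {p \<in> S - {a, v, b}. \<not> P a v b p} = j}"
    by (auto simp: below_def)
  ultimately show ?thesis using \<open>j \<le> M\<close> by (simp add: Suc_diff_le)
qed

section \<open>The extremal pair\<close>

text \<open>The determinant with rows \<open>(u1, w1, z1)\<close>, \<open>(u2, w2, z2)\<close>,
  \<open>(u3, w3, z3)\<close>.\<close>

definition det3 :: "real \<Rightarrow> real \<Rightarrow> real \<Rightarrow> real \<Rightarrow> real \<Rightarrow> real \<Rightarrow> real \<Rightarrow> real \<Rightarrow> real \<Rightarrow> real" where
  "det3 u1 w1 z1 u2 w2 z2 u3 w3 z3 =
    u1 * (w2 * z3 - z2 * w3) - w1 * (u2 * z3 - z2 * u3) + z1 * (u2 * w3 - w2 * u3)"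

text \<open>The origin is the lifted middle vertex. In the plane \<open>u = 0\<close> all segments
  from \<open>A\<close> to \<open>B\<close> cross in the half-plane \<open>z > 0\<close>, so one of
  the two extreme rays from the origin is picked out by the largest slope. \<open>nz\<close>
  excludes ties.\<close>

lemma extreme_pair:
  fixes u w z :: "'a \<Rightarrow> real"
  defines "D \<equiv> \<lambda>a b p. det3 (u a) (w a) (z a) (u b) (w b) (z b) (u p) (w p) (z p)"
  assumes fin: "finite A" "finite B" and ne: "A \<noteq> {}" "B \<noteq> {}"
    and neg: "\<And>a. a \<in> A \<Longrightarrow> u a < 0" and pos: "\<And>b. b \<in> B \<Longrightarrow> u b > 0"
    and z: "\<And>p. p \<in> A \<union> B \<Longrightarrow> z p > 0"
    and nz: "\<And>a b p. \<lbrakk>a \<in> A; b \<in> B; p \<in> A \<union> B - {a, b}\<rbrakk> \<Longrightarrow> D a b p \<noteq> 0"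
  shows "\<exists>!(a, b). a \<in> A \<and> b \<in> B \<and> (\<forall>p\<in>A \<union> B - {a, b}. \<not> D a b p > 0)"
proof -
  \<comment> \<open>The slope \<open>w / z\<close> of the point where the segment from \<open>a\<close> to \<open>b\<close> meets the plane \<open>u = 0\<close>;
    the extremal pair maximises it.\<close>
  define m where "m = (\<lambda>(a, b). (u b * w a - u a * w b) / (u b * z a - u a * z b))"
  \<comment> \<open>This is also the coefficient of \<open>w p\<close> in \<open>D a b p\<close>, so
    \<open>D a b p > 0\<close> means that \<open>p\<close> lies above the plane in the direction of
    increasing \<open>w\<close>.\<close>
  have den: "u b * z a - u a * z b > 0" if "a \<in> A" "b \<in> B" for a b
  proof -
    have "u b * z a > 0" "u a * z b < 0" using that neg pos z by (auto simp: mult_neg_pos)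
    then show ?thesis by simp
  qed
  \<comment> \<open>\<open>D a b\<close> is linear in its last row. Applied to \<open>u b'\<close>
    times row \<open>a'\<close> minus \<open>u a'\<close> times row \<open>b'\<close>, a multiple of
    the crossing point of the other segment, it gives the cross-multiplied difference of the
    slopes.\<close>
  have m_diff: "m (a, b) < m (a', b') \<longleftrightarrow> u b' * D a b a' - u a' * D a b b' > 0"
    "m (a', b') < m (a, b) \<longleftrightarrow> u b' * D a b a' - u a' * D a b b' < 0"
    if "a \<in> A" "b \<in> B" "a' \<in> A" "b' \<in> B" for a b a' b'
  proof -
    have *: "u b' * D a b a' - u a' * D a b b' = (u b' * w a' - u a' * w b') * (u b * z a - u a * z b)
        - (u b * w a - u a * w b) * (u b' * z a' - u a' * z b')"
      unfolding D_def det3_def by (simp add: algebra_simps)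
    show "m (a, b) < m (a', b') \<longleftrightarrow> u b' * D a b a' - u a' * D a b b' > 0"
      "m (a', b') < m (a, b) \<longleftrightarrow> u b' * D a b a' - u a' * D a b b' < 0"
      using den[OF that(1,2)] den[OF that(3,4)] unfolding * by (simp_all add: m_def frac_less_eq divide_simps mult.commute)
  qed
  have zero: "D a b a = 0" "D a b b = 0" for a b by (simp_all add: D_def det3_def algebra_simps)
  have "finite (m ` (A \<times> B))" "m ` (A \<times> B) \<noteq> {}" using fin ne by auto
  then have Max: "Max (m ` (A \<times> B)) \<in> m ` (A \<times> B)" "\<And>y. y \<in> m ` (A \<times> B) \<Longrightarrow> y \<le> Max (m ` (A \<times> B))"
    by auto
  from Max(1) obtain a b where ab: "a \<in> A" "b \<in> B" and Max_eq: "Max (m ` (A \<times> B)) = m (a, b)"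
    by blast
  have max: "m (a', b') \<le> m (a, b)" if "a' \<in> A" "b' \<in> B" for a' b'
    using Max(2)[of "m (a', b')"] that unfolding Max_eq by blast
  show ?thesis
  proof (rule ex1I[of _ "(a, b)"])
    \<comment> \<open>Only one endpoint of the maximal pair is exchanged for \<open>p\<close>; the
      determinant of the endpoint that is kept has a repeated row and vanishes.\<close>
    have "\<not> D a b p > 0" if p: "p \<in> A \<union> B - {a, b}" for p
    proof (cases "p \<in> A")
      case True
      have "u b * D a b p \<le> 0" using m_diff(1)[OF ab True ab(2)] max[OF True ab(2)] by (simp add: zero)
      then show ?thesis using pos[OF ab(2)] by (simp add: mult_le_0_iff)
    next
      case False
      then have B: "p \<in> B" using p by simp
      have "u a * D a b p \<ge> 0" using m_diff(1)[OF ab ab(1) B] max[OF ab(1) B] by (simp add: zero)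
      then show ?thesis using neg[OF ab(1)] by (simp add: zero_le_mult_iff)
    qed
    with ab show "case (a, b) of (a, b) \<Rightarrow> a \<in> A \<and> b \<in> B \<and> (\<forall>p\<in>A \<union> B - {a, b}. \<not> D a b p > 0)"
      by simp
  next
    fix y assume y: "case y of (a, b) \<Rightarrow> a \<in> A \<and> b \<in> B \<and> (\<forall>p\<in>A \<union> B - {a, b}. \<not> D a b p > 0)"
    obtain a' b' where y': "y = (a', b')" by (cases y)
    with y have ab': "a' \<in> A" "b' \<in> B" and below: "\<forall>p\<in>A \<union> B - {a', b'}. \<not> D a' b' p > 0" by auto
    have lt: "D a' b' p < 0" if "p \<in> A \<union> B" "p \<noteq> a'" "p \<noteq> b'" for p
      using below nz[OF ab', of p] that by force
    have AB: "a \<noteq> b'" "b \<noteq> a'" using neg pos ab ab' by force+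
    \<comment> \<open>If the pairs differed, at least one of the two terms would be strict and the
      other would not compensate it, so \<open>m (a, b) < m (a', b')\<close>, against
      maximality.\<close>
    have a: "u b * D a' b' a < 0 \<or> a = a'" using lt[of a] ab AB pos[OF ab(2)] by (auto simp: mult_pos_neg)
    have b: "u a * D a' b' b > 0 \<or> b = b'" using lt[of b] ab AB neg[OF ab(1)] by (auto simp: mult_neg_neg)
    have "\<not> u b * D a' b' a - u a * D a' b' b < 0" 
      using m_diff(2)[OF ab' ab] max[OF ab'] by simp
    with a b have "a = a' \<and> b = b'" by (auto simp: zero)
    then show "y = (a, b)" by (simp add: y')
  qed
qed

section \<open>The incircle determinant\<close>

text \<open>Together with \<open>wcoord\<close> this is a rotation of the plane scaled by the square
  root of \<open>1 + t^2\<close>; \<open>t\<close> is chosen to separate the points of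
  \<open>S\<close>.\<close>

definition ucoord :: "real \<Rightarrow> point \<Rightarrow> real" where
  "ucoord t p = p$1 + t * p$2"

definition wcoord :: "real \<Rightarrow> point \<Rightarrow> real" where
  "wcoord t p = p$2 - t * p$1"

text \<open>Here \<open>z\<close> is the square of the distance from \<open>v\<close>, up to the factor \<open>1 + t\<^sup>2\<close>, so the sign of the
  determinant tells on which side of the plane through the lifted \<open>a\<close>, \<open>v\<close>, \<open>b\<close> the lifted \<open>p\<close> lies.\<close>

definition incircle :: "real \<Rightarrow> point \<Rightarrow> point \<Rightarrow> point \<Rightarrow> point \<Rightarrow> real" where
  "incircle t a v b p = (let u = \<lambda>q. ucoord t q - ucoord t v; w = \<lambda>q. wcoord t q - wcoord t v;
     z = \<lambda>q. (u q)\<^sup>2 + (w q)\<^sup>2 in det3 (u a) (w a) (z a) (u b) (w b) (z b) (u p) (w p) (z p))"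

text \<open>Twice the signed area of the triangle \<open>v\<close>, \<open>a\<close>,
  \<open>b\<close>.\<close>

definition cross :: "point \<Rightarrow> point \<Rightarrow> point \<Rightarrow> real" where
  "cross a v b = (a$1 - v$1) * (b$2 - v$2) - (a$2 - v$2) * (b$1 - v$1)"

lemma ex_inj_on_ucoord:
  assumes "finite S"
  shows "\<exists>t. inj_on (ucoord t) S"
proof -
  \<comment> \<open>Two distinct points share a \<open>ucoord\<close> for at most one
    \<open>t\<close>. Pairs with equal second coordinates yield 0 by division by zero, which only
    adds a harmless excluded value.\<close>
  let ?bad = "(\<lambda>(p, q). (p$1 - q$1) / (q$2 - p$2)) ` (S \<times> S)"
  obtain t where t: "t \<notin> ?bad"
    using assms ex_new_if_finite[OF infinite_UNIV_char_0, of ?bad] by blast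
  have "inj_on (ucoord t) S"
  proof (rule inj_onI, rule ccontr)
    fix p q assume pq: "p \<in> S" "q \<in> S" "ucoord t p = ucoord t q" "p \<noteq> q"
    have eq: "p$1 - q$1 = t * (q$2 - p$2)" using pq(3) by (simp add: ucoord_def algebra_simps)
    have "q$2 - p$2 \<noteq> 0" using eq pq(4) by (auto simp: vec_eq_iff forall_2)
    with eq have "t = (p$1 - q$1) / (q$2 - p$2)" by simp
    then have "t \<in> ?bad" using pq by (intro image_eqI[of _ _ "(p, q)"]) auto
    then show False using t by blast
  qed
  then show ?thesis ..
qed

lemma dist_square_2: "(dist p q)\<^sup>2 = (p$1 - q$1)\<^sup>2 + (p$2 - q$2)\<^sup>2" for p q :: point
  by (simp add: dist_vec_def L2_set_def sum_2 dist_real_def)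

text \<open>Relative to \<open>v\<close>, the coordinate \<open>z q\<close> is a multiple of the
  power of \<open>q\<close> with respect to the circle plus a linear function of \<open>u q\<close>
  and \<open>w q\<close>. A column operation removes the linear part; the powers of \<open>a\<close>
  and \<open>b\<close> vanish, leaving the power of \<open>p\<close> times a minor.\<close>

lemma incircle_eq:
  assumes mem: "a \<in> sphere c r" "v \<in> sphere c r" "b \<in> sphere c r"
  shows "incircle t a v b p = (1 + t\<^sup>2)\<^sup>2 * cross a v b * ((dist c p)\<^sup>2 - r\<^sup>2)"
proof -
  define u where "u q = ucoord t q - ucoord t v" for q
  define w where "w q = wcoord t q - wcoord t v" for q
  define z where "z q = (u q)\<^sup>2 + (w q)\<^sup>2" for q
  have scale: "(u q - u q')\<^sup>2 + (w q - w q')\<^sup>2 = (1 + t\<^sup>2) * (dist q q')\<^sup>2" for q q'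
    unfolding u_def w_def ucoord_def wcoord_def dist_square_2
    by (simp add: power2_eq_square algebra_simps)
  have v0: "u v = 0" "w v = 0" by (simp_all add: u_def w_def)
  have z_eq: "z q = (1 + t\<^sup>2) * ((dist c q)\<^sup>2 - r\<^sup>2) + 2 * (u q * u c + w q * w c)" for q
  proof -
    have "(u c)\<^sup>2 + (w c)\<^sup>2 = (1 + t\<^sup>2) * r\<^sup>2"
      using scale[of c v] mem(2) by (simp add: v0)
    moreover have "(u c - u q)\<^sup>2 + (w c - w q)\<^sup>2 = (u c)\<^sup>2 + (w c)\<^sup>2 + z q - 2 * (u q * u c + w q * w c)"
      unfolding z_def by (simp add: power2_diff algebra_simps)
    ultimately show ?thesis using scale[of c q] by (simp add: right_diff_distrib)
  qed
  have za: "z a = 2 * (u a * u c + w a * w c)" and zb: "z b = 2 * (u b * u c + w b * w c)"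
    using mem z_eq[of a] z_eq[of b] by simp_all
  have det: "det3 u1 w1 (2 * (u1 * A + w1 * B)) u2 w2 (2 * (u2 * A + w2 * B)) u3 w3 (P + 2 * (u3 * A + w3 * B))
      = P * (u1 * w2 - w1 * u2)" for u1 w1 u2 w2 u3 w3 A B P :: real
    unfolding det3_def by algebra
  have "incircle t a v b p = det3 (u a) (w a) (z a) (u b) (w b) (z b) (u p) (w p) (z p)"
    by (simp add: incircle_def Let_def u_def w_def z_def)
  also have "\<dots> = (1 + t\<^sup>2) * ((dist c p)\<^sup>2 - r\<^sup>2) * (u a * w b - w a * u b)"
    unfolding za zb z_eq[of p] det ..
  also have "u a * w b - w a * u b = (1 + t\<^sup>2) * cross a v b"
    unfolding u_def w_def ucoord_def wcoord_def cross_def by algebra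
  finally show ?thesis by (simp add: power2_eq_square)
qed

section \<open>Collinearity and circumcircles in coordinates\<close>

lemma collinear_if_cross_eq_0:
  assumes "cross a v b = 0"
  shows "collinear {a, v, b}"
proof (cases "a = v")
  case True
  then show ?thesis by simp
next
  case False
  let ?x = "a - v" and ?y = "b - v"
  have e: "?x$1 * ?y$2 = ?x$2 * ?y$1" using assms by (simp add: cross_def)
  have "\<exists>c. ?y = c *\<^sub>R ?x"
  proof (cases "?x$1 = 0")
    case True
    then have nz: "?x$2 \<noteq> 0" using False by (auto simp: vec_eq_iff forall_2)
    then have "?y = (?y$2 / ?x$2) *\<^sub>R ?x"
      using e True unfolding vec_eq_iff forall_2 by simp
    then show ?thesis ..
  next
    case nz: False
    then have "?y = (?y$1 / ?x$1) *\<^sub>R ?x"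
      using e unfolding vec_eq_iff forall_2 by (simp add: nonzero_eq_divide_eq mult.commute)
    then show ?thesis ..
  qed
  then have "collinear {0, ?x, ?y}" by (auto simp: collinear_lemma)
  then show ?thesis by (subst collinear_3) (simp_all add: NO_MATCH_def)
qed

lemma ex_circumcircle:
  assumes K: "cross a v b \<noteq> 0"
  shows "\<exists>c r. r > 0 \<and> {a, v, b} \<subseteq> sphere c r"
proof -
  let ?K = "cross a v b"
  define x y where "x q = q$1 - v$1" and "y q = q$2 - v$2" for q :: point
  let ?z = "\<lambda>q. (x q)\<^sup>2 + (y q)\<^sup>2"
  \<comment> \<open>With \<open>v\<close> as origin, the centre solves
    \<open>2 * (x q * X + y q * Y) = ?z q\<close> for \<open>q = a\<close> and \<open>q = b\<close>;
    this is Cramer's rule with determinant \<open>?K\<close>.\<close>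
  define X where "X = (?z a * y b - ?z b * y a) / (2 * ?K)"
  define Y where "Y = (x a * ?z b - x b * ?z a) / (2 * ?K)"
  have K': "?K = x a * y b - y a * x b" by (simp add: cross_def x_def y_def)
  have "2 * (x a * X + y a * Y) = (x a * (?z a * y b - ?z b * y a) + y a * (x a * ?z b - x b * ?z a)) / ?K"
    using K by (simp add: X_def Y_def field_simps)
  also have "\<dots> = ?z a * ?K / ?K" unfolding K' by (rule arg_cong2[of _ _ _ _ divide]) (simp_all add: algebra_simps)
  finally have a: "2 * (x a * X + y a * Y) = ?z a" using K by simp
  have "2 * (x b * X + y b * Y) = (x b * (?z a * y b - ?z b * y a) + y b * (x a * ?z b - x b * ?z a)) / ?K"
    using K by (simp add: X_def Y_def field_simps)
  also have "\<dots> = ?z b * ?K / ?K" unfolding K' by (rule arg_cong2[of _ _ _ _ divide]) (simp_all add: algebra_simps)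
  finally have b: "2 * (x b * X + y b * Y) = ?z b" using K by simp
  define c :: point where "c = vector [v$1 + X, v$2 + Y]"
  have c: "c$1 = v$1 + X" "c$2 = v$2 + Y" by (simp_all add: c_def)
  have eq: "(dist c q)\<^sup>2 = (dist c v)\<^sup>2" if "2 * (x q * X + y q * Y) = ?z q" for q
    using that unfolding dist_square_2 c by (simp add: x_def y_def power2_eq_square algebra_simps)
  have da: "dist c a = dist c v" and db: "dist c b = dist c v"
    using eq[OF a] eq[OF b] by simp_all
  have "dist c v \<noteq> 0"
  proof
    assume "dist c v = 0"
    then have "a = v" using da by simp
    then show False using K by (simp add: cross_def)
  qed
  then have "dist c v > 0 \<and> {a, v, b} \<subseteq> sphere c (dist c v)" using da db by simp
  then show ?thesis by blast
qed

text \<open>By \<open>incircle_eq\<close> both circles give every point the same power. Evaluated at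
  the two centres, this forces the squared distance between them to equal its own negative.\<close>

lemma circumcircle_unique:
  assumes K: "cross a v b \<noteq> 0"
    and r: "r > 0" "{a, v, b} \<subseteq> sphere c r" and r': "r' > 0" "{a, v, b} \<subseteq> sphere c' r'"
  shows "sphere c r = sphere c' r'"
proof -
  have eq: "(dist c p)\<^sup>2 - r\<^sup>2 = (dist c' p)\<^sup>2 - r'\<^sup>2" for p
    using incircle_eq[of a c r v b 0 p] incircle_eq[of a c' r' v b 0 p] assms by simp
  have "- r\<^sup>2 = (dist c c')\<^sup>2 - r'\<^sup>2" "(dist c c')\<^sup>2 - r\<^sup>2 = - r'\<^sup>2"
    using eq[of c] eq[of c'] by (simp_all add: dist_commute)
  then have "(dist c c')\<^sup>2 = 0" by linarith
  then have "c = c'" by simp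
  moreover have "r = r'" using r r' \<open>c = c'\<close> by simp
  ultimately show ?thesis by simp
qed

section \<open>Points in general position\<close>

lemma cross_nonzero:
  assumes "general_position S" "{a, v, b} \<subseteq> S" "distinct [a, v, b]"
  shows "cross a v b \<noteq> 0"
proof -
  have "card {a, v, b} = 3" using assms(3) by simp
  then have "\<not> collinear {a, v, b}" using assms unfolding general_position_def by meson
  then show ?thesis using collinear_if_cross_eq_0 by blast
qed

lemma not_on_sphere:
  assumes "general_position S" "{a, v, b} \<subseteq> S" "distinct [a, v, b]"
    and "r > 0" "{a, v, b} \<subseteq> sphere c r" and p: "p \<in> S - {a, v, b}"
  shows "dist c p \<noteq> r"
proof
  assume "dist c p = r"
  then have "concyclic {p, a, v, b}"
    using assms(4,5) unfolding concyclic_def is_circle_def by (intro exI[of _ "sphere c r"]) auto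
  moreover have "card {p, a, v, b} = 4" using assms(3) p by auto
  moreover have "{p, a, v, b} \<subseteq> S" using assms by auto
  ultimately show False using assms(1) unfolding general_position_def by meson
qed

text \<open>The two halves of general position give the two nonzero factors: no collinear triple for
  \<open>cross\<close>, no concyclic quadruple for the power of \<open>p\<close>.\<close>

lemma incircle_nonzero:
  assumes "general_position S" "{a, v, b} \<subseteq> S" "distinct [a, v, b]" and p: "p \<in> S - {a, v, b}"
  shows "incircle t a v b p \<noteq> 0"
proof -
  have K: "cross a v b \<noteq> 0" using cross_nonzero assms by blast
  then obtain c r where cr: "r > 0" "{a, v, b} \<subseteq> sphere c r" using ex_circumcircle by blast
  have "dist c p \<noteq> r" using not_on_sphere[OF assms(1-3) cr p] .
  then have "(dist c p)\<^sup>2 - r\<^sup>2 \<noteq> 0" using cr by (simp add: power2_eq_iff_nonneg)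
  moreover have "1 + t\<^sup>2 \<noteq> 0" using zero_le_power2[of t] by linarith
  ultimately show ?thesis using incircle_eq[of a c r v b t p] cr K by simp
qed

text \<open>\<open>extreme_pair\<close> in coordinates centred at \<open>v\<close>, with
  \<open>A\<close> and \<open>B\<close> the points of \<open>R\<close> on either side of
  \<open>v\<close>. Injectivity of \<open>ucoord t\<close> makes them exhaust
  \<open>R - {v}\<close>.\<close>

lemma ex1_extreme_triple:
  assumes gp: "general_position S" and "finite S" and inj: "inj_on (ucoord t) S"
    and R: "R \<subseteq> S" "v \<in> R"
    and ex: "\<exists>a\<in>R. ucoord t a < ucoord t v" "\<exists>b\<in>R. ucoord t v < ucoord t b"
  shows "\<exists>!(a, b). (a, v, b) \<in> sorted_triples (ucoord t) R \<and>
    above_free (\<lambda>a v b p. incircle t a v b p > 0) R (a, v, b)"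
proof -
  define A where "A = {p \<in> R. ucoord t p < ucoord t v}"
  define B where "B = {p \<in> R. ucoord t v < ucoord t p}"
  have "q = v" if "q \<in> R" "ucoord t q = ucoord t v" for q
    using that R inj_onD[OF inj] by blast
  then have AB: "A \<union> B = R - {v}" unfolding A_def B_def by (auto; force)
  have "finite R" using R \<open>finite S\<close> finite_subset by blast
  define u where "u q = ucoord t q - ucoord t v" for q
  define w where "w q = wcoord t q - wcoord t v" for q
  define z where "z q = (u q)\<^sup>2 + (w q)\<^sup>2" for q
  have D: "det3 (u a) (w a) (z a) (u b) (w b) (z b) (u p) (w p) (z p) = incircle t a v b p" for a b p
    by (simp add: incircle_def Let_def u_def w_def z_def)
  have "\<exists>!(a, b). a \<in> A \<and> b \<in> B \<and> (\<forall>p\<in>A \<union> B - {a, b}.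
      \<not> det3 (u a) (w a) (z a) (u b) (w b) (z b) (u p) (w p) (z p) > 0)"
  proof (rule extreme_pair)
    show "finite A" "finite B" using \<open>finite R\<close> by (auto simp: A_def B_def)
    show "A \<noteq> {}" "B \<noteq> {}" using ex by (auto simp: A_def B_def)
    show neg: "u a < 0" if "a \<in> A" for a using that by (simp add: A_def u_def)
    show pos: "u b > 0" if "b \<in> B" for b using that by (simp add: B_def u_def)
    show "z p > 0" if "p \<in> A \<union> B" for p
      using that neg[of p] pos[of p] unfolding z_def by (intro add_pos_nonneg) auto
    show "det3 (u a) (w a) (z a) (u b) (w b) (z b) (u p) (w p) (z p) \<noteq> 0"
      if "a \<in> A" "b \<in> B" "p \<in> A \<union> B - {a, b}" for a b p
    proof -
      have "{a, v, b} \<subseteq> S" "distinct [a, v, b]" using that R by (auto simp: A_def B_def)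
      moreover have "p \<in> S - {a, v, b}" using that R AB by auto
      ultimately show ?thesis unfolding D using incircle_nonzero[OF gp] by blast
    qed
  qed
  moreover have "(a \<in> A \<and> b \<in> B \<and> (\<forall>p\<in>A \<union> B - {a, b}. \<not> incircle t a v b p > 0)) \<longleftrightarrow>
      ((a, v, b) \<in> sorted_triples (ucoord t) R \<and> above_free (\<lambda>a v b p. incircle t a v b p > 0) R (a, v, b))" for a b
  proof -
    have "A \<union> B - {a, b} = R - {a, v, b}" using AB by auto
    then show ?thesis using R(2) by (auto simp: A_def B_def sorted_triples_def above_free_def)
  qed
  ultimately show ?thesis unfolding D by simp
qed

section \<open>From sorted triples to circles\<close>

lemma ex_sorted_triple:
  fixes u :: "'a \<Rightarrow> real"
  assumes "T \<subseteq> S" "card T = 3" "inj_on u S"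
  shows "\<exists>a v b. (a, v, b) \<in> sorted_triples u S \<and> T = {a, v, b}"
proof -
  obtain x y z where T: "T = {x, y, z}" "x \<noteq> y" "y \<noteq> z" "x \<noteq> z"
    using assms(2) by (auto simp: card_3_iff)
  then have S: "x \<in> S" "y \<in> S" "z \<in> S" and ne: "u x \<noteq> u y" "u y \<noteq> u z" "u x \<noteq> u z"
    using assms(1) inj_onD[OF assms(3)] by blast+
  then consider "u x < u y" "u y < u z" | "u x < u z" "u z < u y" | "u y < u x" "u x < u z"
    | "u y < u z" "u z < u x" | "u z < u x" "u x < u y" | "u z < u y" "u y < u x"
    by linarith
  then show ?thesis
    unfolding T(1) sorted_triples_def using S by cases (simp; blast)+
qed

lemma sorted_triples_determined:
  assumes "(a, v, b) \<in> sorted_triples u S" "(a', v', b') \<in> sorted_triples u S" "{a, v, b} = {a', v', b'}"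
  shows "(a, v, b) = (a', v', b')"
proof -
  have "a' \<in> {a, v, b}" "v' \<in> {a, v, b}" "b' \<in> {a, v, b}" using assms(3) by auto
  then show ?thesis using assms(1,2) by (auto simp: sorted_triples_def)
qed

text \<open>The sign of \<open>incircle\<close> is the orientation \<open>cross\<close> times the
  side of the circle. Hence the points not above the plane are those inside for positive orientation
  and those outside for negative.\<close>

lemma below_card_cases:
  fixes S :: "point set" and t :: real
  assumes gp: "general_position S" and "finite S" and sub: "{a, v, b} \<subseteq> S" and dist: "distinct [a, v, b]"
    and cr: "r > 0" "{a, v, b} \<subseteq> sphere c r"
  defines "m \<equiv> card {p \<in> S - {a, v, b}. \<not> incircle t a v b p > 0}"
  shows "m = card (S \<inter> ball c r) \<or> m = card (S - cball c r)"
    and "card (S \<inter> ball c r) + card (S - cball c r) = card S - 3"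
proof -
  have eq: "incircle t a v b p = (1 + t\<^sup>2)\<^sup>2 * cross a v b * ((dist c p)\<^sup>2 - r\<^sup>2)" for p
    using incircle_eq cr by blast
  have K: "cross a v b \<noteq> 0" using cross_nonzero[OF gp sub dist] .
  have t: "(1 + t\<^sup>2)\<^sup>2 > 0" using zero_le_power2[of t] by (intro zero_less_power) linarith
  have sq: "(dist c p)\<^sup>2 < r\<^sup>2 \<longleftrightarrow> dist c p < r" "r\<^sup>2 < (dist c p)\<^sup>2 \<longleftrightarrow> r < dist c p" for p
    using cr by (simp_all add: power2_less_imp_less abs_square_less_1 flip: abs_le_square_iff not_le)
  have ns: "dist c p \<noteq> r" if "p \<in> S - {a, v, b}" for p using not_on_sphere[OF gp sub dist cr that] .
  have on: "dist c a = r" "dist c v = r" "dist c b = r" using cr by auto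
  show "m = card (S \<inter> ball c r) \<or> m = card (S - cball c r)"
  proof (cases "cross a v b > 0")
    case True
    then have k: "(1 + t\<^sup>2)\<^sup>2 * cross a v b > 0" using t by simp
    have "incircle t a v b p > 0 \<longleftrightarrow> dist c p > r" for p
      unfolding eq using k by (simp add: zero_less_mult_iff[of "_ * cross a v b"] sq)
    moreover have "p \<in> S - {a, v, b} \<and> \<not> dist c p > r \<longleftrightarrow> p \<in> S \<inter> ball c r" for p
      using ns[of p] on by (cases "p \<in> {a, v, b}") auto
    ultimately have "{p \<in> S - {a, v, b}. \<not> incircle t a v b p > 0} = S \<inter> ball c r" by blast
    then show ?thesis by (simp add: m_def)
  next
    case False
    then have k: "(1 + t\<^sup>2)\<^sup>2 * cross a v b < 0" using t K by (simp add: mult_pos_neg)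
    have "incircle t a v b p > 0 \<longleftrightarrow> dist c p < r" for p
      unfolding eq using k by (simp add: zero_less_mult_iff[of "_ * cross a v b"] sq)
    moreover have "p \<in> S - {a, v, b} \<and> \<not> dist c p < r \<longleftrightarrow> p \<in> S - cball c r" for p
      using ns[of p] on by (cases "p \<in> {a, v, b}") auto
    ultimately have "{p \<in> S - {a, v, b}. \<not> incircle t a v b p > 0} = S - cball c r" by blast
    then show ?thesis by (simp add: m_def)
  qed
  have "S - {a, v, b} = (S \<inter> ball c r) \<union> (S - cball c r)" using ns on by fastforce
  then have "card (S - {a, v, b}) = card (S \<inter> ball c r) + card (S - cball c r)"
    using card_Un_disjoint[of "S \<inter> ball c r" "S - cball c r"] \<open>finite S\<close> by force
  moreover have "card (S - {a, v, b}) = card S - 3" using sub dist by (simp add: card_Diff_subset)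
  ultimately show "card (S \<inter> ball c r) + card (S - cball c r) = card S - 3" by simp
qed

theorem theorem2:
  fixes n a b :: nat and S :: "point set"
  assumes "n > 0"
    and "finite S" and "card S = 2 * n + 1"
    and "general_position S"
    and "a < b" and "a + b = 2 * n - 2"
  shows "card {C. splitting S a b C \<or> splitting S b a C} = 2 * (a + 1) * (b + 1)"
proof -
  \<comment> \<open>As \<open>n > 0\<close>, the truncated subtraction is exact and
    \<open>card S = M + 3\<close>.\<close>
  define M where "M = 2 * n - 2"
  have card_S: "card S = M + 3" and ab: "a + b = M" using assms by (auto simp: M_def)
  obtain t where inj: "inj_on (ucoord t) S" using ex_inj_on_ucoord[OF \<open>finite S\<close>] by blast
  let ?X = "sorted_triples (ucoord t) S"
  define below where "below = (\<lambda>(x, v, y). card {p \<in> S - {x, v, y}. \<not> incircle t x v y p > 0})"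
  define circ where "circ = (\<lambda>(x, v, y). SOME C. is_circle C \<and> {x, v, y} \<subseteq> C)"
  have X: "{x, v, y} \<subseteq> S" "distinct [x, v, y]" if "(x, v, y) \<in> ?X" for x v y
    using that by (auto simp: sorted_triples_def)
  have circ: "is_circle (circ (x, v, y)) \<and> {x, v, y} \<subseteq> circ (x, v, y)" if "(x, v, y) \<in> ?X" for x v y
  proof -
    have "\<exists>C. is_circle C \<and> {x, v, y} \<subseteq> C"
      using ex_circumcircle[OF cross_nonzero[OF \<open>general_position S\<close> X[OF that]]] unfolding is_circle_def by blast
    then show ?thesis unfolding circ_def prod.case by (rule someI_ex)
  qed
  have circ_eq: "circ (x, v, y) = sphere c r"
    if "(x, v, y) \<in> ?X" "r > 0" "{x, v, y} \<subseteq> sphere c r" for x v y c r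
    using circ[OF that(1)] circumcircle_unique[OF cross_nonzero[OF \<open>general_position S\<close> X[OF that(1)]] _ _ that(2,3)]
    unfolding is_circle_def by blast
  have level: "card {\<tau> \<in> ?X. below \<tau> = j} = (j + 1) * (M - j + 1)" if "j \<le> M" for j
  proof -
    have "{\<tau> \<in> ?X. below \<tau> = j} =
        {(x, v, y) \<in> ?X. card {p \<in> S - {x, v, y}. \<not> incircle t x v y p > 0} = j}"
      by (auto simp: below_def)
    then show ?thesis
      using card_sorted_triples_level[OF \<open>finite S\<close> inj card_S, of "\<lambda>a v b p. incircle t a v b p > 0" j]
        ex1_extreme_triple[OF \<open>general_position S\<close> \<open>finite S\<close> inj] that by simp
  qed
  \<comment> \<open>The orientation is unknown, so \<open>below\<close> is only known to be one of
    the two counts. As they sum to \<open>a + b\<close>, its lying in \<open>{a, b}\<close> fixes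
    the unordered split, which is why both kinds of circle are counted together.\<close>
  have below_iff: "splitting S a b (sphere c r) \<or> splitting S b a (sphere c r) \<longleftrightarrow> below (x, v, y) \<in> {a, b}"
    if \<tau>: "(x, v, y) \<in> ?X" and cr: "r > 0" "{x, v, y} \<subseteq> sphere c r" for x v y c r
  proof -
    have three: "through_three S (sphere c r)"
      unfolding through_three_def using X[OF \<tau>] cr by (intro exI[of _ "{x, v, y}"]) simp
    note cases = below_card_cases[OF \<open>general_position S\<close> \<open>finite S\<close> X[OF \<tau>]]
    \<comment> \<open>Stated for every centre and radius, since \<open>splitting\<close> supplies
      its own pair \<open>c'\<close>, \<open>r'\<close>.\<close>
    have side: "below (x, v, y) = card (S \<inter> ball c r) \<or> below (x, v, y) = card (S - cball c r)"
      if "r > 0" "{x, v, y} \<subseteq> sphere c r" for c r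
      unfolding below_def prod.case by (rule cases(1)[OF that])
    have total: "card (S \<inter> ball c r) + card (S - cball c r) = a + b"
      using cases(2)[OF cr] card_S ab by simp
    show ?thesis
    proof
      assume "splitting S a b (sphere c r) \<or> splitting S b a (sphere c r)"
      then obtain c' r' where c': "r' > 0" "sphere c r = sphere c' r'"
        and "(card (S \<inter> ball c' r') = a \<and> card (S - cball c' r') = b) \<or>
          (card (S \<inter> ball c' r') = b \<and> card (S - cball c' r') = a)"
        unfolding splitting_def by blast
      then show "below (x, v, y) \<in> {a, b}"
        using side[of r' c'] cr by auto
    next
      assume "below (x, v, y) \<in> {a, b}"
      then have "(card (S \<inter> ball c r) = a \<and> card (S - cball c r) = b) \<or>
          (card (S \<inter> ball c r) = b \<and> card (S - cball c r) = a)"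
        using side[OF cr] total by auto
      then show "splitting S a b (sphere c r) \<or> splitting S b a (sphere c r)"
        unfolding splitting_def using three cr(1) by blast
    qed
  qed
  have "bij_betw circ {\<tau> \<in> ?X. below \<tau> \<in> {a, b}} {C. splitting S a b C \<or> splitting S b a C}"
    unfolding bij_betw_def
  proof (intro conjI equalityI subsetI)
    show "inj_on circ {\<tau> \<in> ?X. below \<tau> \<in> {a, b}}"
    proof (rule inj_onI)
      fix \<sigma> \<tau> assume mem: "\<sigma> \<in> {\<tau> \<in> ?X. below \<tau> \<in> {a, b}}" "\<tau> \<in> {\<tau> \<in> ?X. below \<tau> \<in> {a, b}}"
        and eq: "circ \<sigma> = circ \<tau>"
      obtain x v y where \<sigma>: "\<sigma> = (x, v, y)" by (cases \<sigma>)
      obtain x' v' y' where \<tau>: "\<tau> = (x', v', y')" by (cases \<tau>)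
      have X': "(x, v, y) \<in> ?X" "(x', v', y') \<in> ?X" using mem by (auto simp: \<sigma> \<tau>)
      obtain c r where cr: "r > 0" "circ \<sigma> = sphere c r"
        using circ[OF X'(1)] unfolding \<sigma> is_circle_def by blast
      have sub: "{x, v, y} \<subseteq> sphere c r" "{x', v', y'} \<subseteq> sphere c r"
        using circ[OF X'(1)] circ[OF X'(2)] cr eq unfolding \<sigma> \<tau> by auto
      \<comment> \<open>A further point of \<open>S\<close> on the circle would give four concyclic
        points, so the circle determines its triple.\<close>
      have "{x', v', y'} \<subseteq> {x, v, y}"
      proof
        fix p assume p: "p \<in> {x', v', y'}"
        have "p \<in> S" "dist c p = r" using subsetD[OF sub(2) p] subsetD[OF X(1)[OF X'(2)] p] by simp_all
        then show "p \<in> {x, v, y}"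
          using not_on_sphere[OF \<open>general_position S\<close> X[OF X'(1)] cr(1) sub(1), of p] by blast
      qed
      moreover have "card {x', v', y'} = card {x, v, y}" using X(2)[OF X'(1)] X(2)[OF X'(2)] by simp
      ultimately have "{x, v, y} = {x', v', y'}" by (intro card_subset_eq[symmetric]) auto
      then show "\<sigma> = \<tau>" unfolding \<sigma> \<tau> by (rule sorted_triples_determined[OF X'])
    qed
  next
    fix C assume "C \<in> circ ` {\<tau> \<in> ?X. below \<tau> \<in> {a, b}}"
    then obtain x v y where \<tau>: "(x, v, y) \<in> ?X" "below (x, v, y) \<in> {a, b}" "C = circ (x, v, y)"
      by auto
    then obtain c r where "r > 0" "C = sphere c r" "{x, v, y} \<subseteq> sphere c r"
      using circ[OF \<tau>(1)] unfolding is_circle_def by auto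
    then show "C \<in> {C. splitting S a b C \<or> splitting S b a C}" using below_iff[OF \<tau>(1)] \<tau>(2) by blast
  next
    fix C assume C: "C \<in> {C. splitting S a b C \<or> splitting S b a C}"
    then obtain T c r where T: "T \<subseteq> S" "card T = 3" "T \<subseteq> C" and cr: "r > 0" "C = sphere c r"
      unfolding splitting_def through_three_def by blast
    obtain x v y where \<tau>: "(x, v, y) \<in> ?X" "T = {x, v, y}" using ex_sorted_triple[OF T(1,2) inj] by blast
    have "{x, v, y} \<subseteq> sphere c r" using T \<tau> cr by simp
    then have "C = circ (x, v, y)" "below (x, v, y) \<in> {a, b}"
      using circ_eq[OF \<tau>(1) cr(1)] below_iff[OF \<tau>(1) cr(1)] C cr by auto
    then show "C \<in> circ ` {\<tau> \<in> ?X. below \<tau> \<in> {a, b}}" using \<tau>(1) by blast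
  qed
  then have "card {C. splitting S a b C \<or> splitting S b a C} = card {\<tau> \<in> ?X. below \<tau> \<in> {a, b}}"
    by (simp add: bij_betw_same_card)
  also have "{\<tau> \<in> ?X. below \<tau> \<in> {a, b}} = {\<tau> \<in> ?X. below \<tau> = a} \<union> {\<tau> \<in> ?X. below \<tau> = b}" by auto
  also have "card \<dots> = card {\<tau> \<in> ?X. below \<tau> = a} + card {\<tau> \<in> ?X. below \<tau> = b}"
    using finite_sorted_triples[OF \<open>finite S\<close>] \<open>a < b\<close> by (intro card_Un_disjoint) auto
  \<comment> \<open>Since \<open>M - a = b\<close> and \<open>M - b = a\<close>, the levels
    \<open>a\<close> and \<open>b\<close> have the same size.\<close>
  also have "\<dots> = (a + 1) * (b + 1) + (b + 1) * (a + 1)"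
  proof -
    have "a \<le> M" "b \<le> M" "M - a = b" "M - b = a" using ab by auto
    with level[of a] level[of b] show ?thesis by simp
  qed
  finally show ?thesis by (simp add: algebra_simps)
qed

end
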